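(* For $y\in X$ we have \begin{align*} A^*y^{\downarrow\downarrow}&=q^{-\dim y}y^{\downarrow\downarrow}+(q-1)q^{-\dim y}\sum_{y\text{ covers }z}z^{\downarrow\downarrow},\\ A^+y^{\downarrow\downarrow}&=\frac{q^{N-\dim y}}{q-1}y^{\downarrow\downarrow}-\sum_{z\text{ covers }y}z^{\downarrow\downarrow},\\ A^-y^{\downarrow\downarrow}&=\frac{q^{\dim y}}{q-1}y^{\downarrow\downarrow},\\ Ay^{\downarrow\downarrow}&=\frac{\varphi q^{\dim y}-q^{N-\dim y}}{q-1}y^{\downarrow\downarrow}+\sum_{z\text{ covers }y}z^{\downarrow\downarrow}. \end{align*} Here the sums are over all $z\in X$ satisfying the indicated covering condition.
   Context: Let $q$ be a prime power, $GF(q)$ the field with $q$ elements, $N\ge 1$ an integer, and $\mathbf V$ an $N$-dimensional vector space over $GF(q)$. Let $X$ be the set of all subspaces of $\mathbf V$, ordered by inclusion (the projective geometry $L_N(q)$). For $y,z\in X$, $y$ covers $z$ means $z\subseteq y$ and $\dim y-\dim z=1$. ${\rm Mat}_X(\mathbb C)$ is the algebra of complex matrices with rows and columns indexed by $X$; it acts on $V=\mathbb C^X$ by left multiplication. For $y\in X$, $\hat y\in V$ has $y$-coordinate $1$ and all other coordinates $0$. $A^*\in{\rm Mat}_X(\mathbb C)$ is the diagonal matrix with $(y,y)$-entry $q^{-\dim y}$. $R,L\in{\rm Mat}_X(\mathbb C)$: $R_{y,z}=1$ if $y$ covers $z$ and $0$ otherwise; $L_{y,z}=1$ if $z$ covers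 $y$ and $0$ otherwise. Fix a real number $\varphi>0$ and define \[ A=R+\varphi(A^* )^{-1}L+\frac{\varphi-1}{q-1}(A^* )^{-1},\quad A^+=\frac{(A^* )^{-1}}{q-1}-R,\quad A^-=\frac{(A^* )^{-1}}{q-1}+(A^* )^{-1}L . \] With $[n]_q=\frac{q^n-1}{q-1}$ and $[n]_q^!=[n]_q\cdots[1]_q$ ($[0]_q^!=1$), for nilpotent $\psi$ define $\exp_{q^{-1/2}}(\psi)=\sum_{i\ge0}\frac{1}{[i]_q^!}\psi^i$. For $y\in X$ define $y^{\downarrow\downarrow}=\exp_{q^{-1/2}}(L)\hat y$. *)

theory Defs
  imports "HOL-Analysis.Analysis"
begin

text \<open>
  Matrices with rows and columns indexed by a finite set \<open>X\<close> are functions of two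
  arguments that vanish off \<open>X \<times> X\<close>; vectors of \<open>\<complex>\<^sup>X\<close> are functions that vanish off \<open>X\<close>.
  A matrix type \<open>complex ^ 'x ^ 'x\<close> cannot be used, because the index set (the subspaces of an
  arbitrary vector space) is not a type.
\<close>

type_synonym 'x cvec = "'x \<Rightarrow> complex"
type_synonym 'x cmat = "'x \<Rightarrow> 'x \<Rightarrow> complex"

definition Mat :: "'x set \<Rightarrow> 'x cmat set" where
  "Mat X = {M. \<forall>y z. y \<notin> X \<or> z \<notin> X \<longrightarrow> M y z = 0}"

definition mat_one :: "'x set \<Rightarrow> 'x cmat" where
  "mat_one X = (\<lambda>y z. if y \<in> X \<and> y = z then 1 else 0)"

definition mat_mult :: "'x set \<Rightarrow> 'x cmat \<Rightarrow> 'x cmat \<Rightarrow> 'x cmat" where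
  "mat_mult X M P = (\<lambda>y z. if y \<in> X \<and> z \<in> X then \<Sum>w\<in>X. M y w * P w z else 0)"

primrec mat_pow :: "'x set \<Rightarrow> 'x cmat \<Rightarrow> nat \<Rightarrow> 'x cmat" where
  "mat_pow X M 0 = mat_one X"
| "mat_pow X M (Suc n) = mat_mult X M (mat_pow X M n)"

definition mat_inv :: "'x set \<Rightarrow> 'x cmat \<Rightarrow> 'x cmat" where
  "mat_inv X M = (THE P. P \<in> Mat X \<and> mat_mult X M P = mat_one X \<and> mat_mult X P M = mat_one X)"

definition mat_vec :: "'x set \<Rightarrow> 'x cmat \<Rightarrow> 'x cvec \<Rightarrow> 'x cvec" where
  "mat_vec X M v = (\<lambda>y. if y \<in> X then \<Sum>z\<in>X. M y z * v z else 0)"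

definition unit_vec :: "'x \<Rightarrow> 'x cvec" where
  "unit_vec y = (\<lambda>z. if z = y then 1 else 0)"

definition q_int :: "nat \<Rightarrow> nat \<Rightarrow> complex" where
  "q_int q n = (of_nat q ^ n - 1) / (of_nat q - 1)"

definition q_fact :: "nat \<Rightarrow> nat \<Rightarrow> complex" where
  "q_fact q n = (\<Prod>k=1..n. q_int q k)"

text \<open>
  The exponential \<open>exp\<^sub>p\<close> with \<open>p = q\<^bsup>-1/2\<^esup>\<close>, parametrised by \<open>q\<close>. It is meant for nilpotent
  matrices, for which each of the entrywise series has only finitely many nonzero terms.
\<close>

definition q_exp :: "'x set \<Rightarrow> nat \<Rightarrow> 'x cmat \<Rightarrow> 'x cmat" where
  "q_exp X q M = (\<lambda>y z. \<Sum>i. 1 / q_fact q i * mat_pow X M i y z)"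

text \<open>
  Below, \<open>s :: 'a \<Rightarrow> 'v \<Rightarrow> 'v\<close> is the scalar multiplication of a vector space \<open>'v\<close> over the finite
  field \<open>'a\<close>, so that \<open>q = CARD('a)\<close>. Since the library sets \<open>dim\<close> to \<open>0\<close> for infinite-dimensional spaces,
  \<open>dim UNIV = N\<close> with \<open>N \<ge> 1\<close> makes \<open>'v\<close> finite-dimensional, hence finite.
\<close>

definition subspaces :: "('a::field \<Rightarrow> 'v::ab_group_add \<Rightarrow> 'v) \<Rightarrow> 'v set set" where
  "subspaces s = {W. module.subspace s W}"

definition covers :: "('a::field \<Rightarrow> 'v::ab_group_add \<Rightarrow> 'v) \<Rightarrow> 'v set \<Rightarrow> 'v set \<Rightarrow> bool" where
  "covers s y z \<longleftrightarrow>
     z \<subseteq> y \<and> int (vector_space.dim s y) - int (vector_space.dim s z) = 1"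

definition A_star :: "('a::{field,finite} \<Rightarrow> 'v::ab_group_add \<Rightarrow> 'v) \<Rightarrow> 'v set cmat" where
  "A_star s = (\<lambda>y z. if y \<in> subspaces s \<and> y = z
     then of_nat CARD('a) powi (- int (vector_space.dim s y)) else 0)"

definition A_star_inv :: "('a::{field,finite} \<Rightarrow> 'v::ab_group_add \<Rightarrow> 'v) \<Rightarrow> 'v set cmat" where
  "A_star_inv s = mat_inv (subspaces s) (A_star s)"

definition R_mat :: "('a::field \<Rightarrow> 'v::ab_group_add \<Rightarrow> 'v) \<Rightarrow> 'v set cmat" where
  "R_mat s = (\<lambda>y z. if y \<in> subspaces s \<and> z \<in> subspaces s \<and> covers s y z then 1 else 0)"

definition L_mat :: "('a::field \<Rightarrow> 'v::ab_group_add \<Rightarrow> 'v) \<Rightarrow> 'v set cmat" where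
  "L_mat s = (\<lambda>y z. if y \<in> subspaces s \<and> z \<in> subspaces s \<and> covers s z y then 1 else 0)"

definition A_mat :: "('a::{field,finite} \<Rightarrow> 'v::ab_group_add \<Rightarrow> 'v) \<Rightarrow> real \<Rightarrow> 'v set cmat" where
  "A_mat s \<phi> = (\<lambda>y z. R_mat s y z
     + of_real \<phi> * mat_mult (subspaces s) (A_star_inv s) (L_mat s) y z
     + (of_real \<phi> - 1) / (of_nat CARD('a) - 1) * A_star_inv s y z)"

definition A_plus :: "('a::{field,finite} \<Rightarrow> 'v::ab_group_add \<Rightarrow> 'v) \<Rightarrow> 'v set cmat" where
  "A_plus s = (\<lambda>y z. A_star_inv s y z / (of_nat CARD('a) - 1) - R_mat s y z)"

definition A_minus :: "('a::{field,finite} \<Rightarrow> 'v::ab_group_add \<Rightarrow> 'v) \<Rightarrow> 'v set cmat" where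
  "A_minus s = (\<lambda>y z. A_star_inv s y z / (of_nat CARD('a) - 1)
     + mat_mult (subspaces s) (A_star_inv s) (L_mat s) y z)"

definition ddown :: "('a::{field,finite} \<Rightarrow> 'v::ab_group_add \<Rightarrow> 'v) \<Rightarrow> 'v set \<Rightarrow> 'v set cvec" where
  "ddown s y = mat_vec (subspaces s) (q_exp (subspaces s) CARD('a) (L_mat s)) (unit_vec y)"

end

theory Submission
  imports Defs
begin

text \<open>
  The \<open>w\<close>-entry of \<open>L\<^sup>i y\<close> counts the chains of covers of length \<open>i\<close> from \<open>w\<close> up to \<open>y\<close>, of which there
  are \<open>[i]!\<close> if \<open>w \<subseteq> y\<close> and \<open>dim y - dim w = i\<close>, and none otherwise. So \<open>ddown s y\<close> is the indicator
  of the subspaces of \<open>y\<close>, and each identity becomes, entry by entry, a count of the covers of \<open>w\<close>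
  inside \<open>y\<close> or of the subspaces between \<open>w\<close> and \<open>y\<close> covered by \<open>y\<close>; both numbers are
  \<open>[dim y - dim w]\<close>. Only the identity for \<open>A\<^sup>+\<close> has nonzero terms with \<open>w\<close> not contained in \<open>y\<close>,
  and those cancel by the modular law. The last identity follows from \<open>A = \<phi> A\<^sup>- - A\<^sup>+\<close>.
\<close>

section \<open>q-integers as geometric sums, and q-factorials\<close>

lemma card_finite_field_ge2: "2 \<le> CARD('a::{field,finite})"
proof -
  have "card {0, 1 :: 'a} \<le> CARD('a)"
    by (rule card_mono) auto
  then show ?thesis by simp
qed

lemma q_int_eq_sum:
  assumes "2 \<le> q"
  shows "q_int q k = of_nat (\<Sum>i<k. q ^ i)"
proof -
  have "(of_nat q :: complex) \<noteq> 1" using assms by simp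
  then show ?thesis unfolding q_int_def by (simp add: geometric_sum)
qed

lemma q_fact_Suc: "q_fact q (Suc n) = q_int q (Suc n) * q_fact q n"
  unfolding q_fact_def by (simp add: mult.commute)

lemma q_fact_nonzero:
  assumes "2 \<le> q"
  shows "q_fact q n \<noteq> 0"
proof -
  have "q ^ k \<noteq> 1" if "k \<ge> 1" for k using assms that by simp
  then have "(of_nat q :: complex) ^ k \<noteq> 1" if "k \<ge> 1" for k
    using that by (metis of_nat_1 of_nat_eq_iff of_nat_power)
  moreover have "(of_nat q :: complex) \<noteq> 1" using assms by simp
  ultimately show ?thesis unfolding q_fact_def q_int_def by auto
qed

section \<open>Inverses of matrices over a finite index set\<close>

lemma mat_inv_eqI:
  assumes fin: "finite X" and P: "P \<in> Mat X"
    and MP: "mat_mult X M P = mat_one X" and PM: "mat_mult X P M = mat_one X"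
  shows "mat_inv X M = P"
  unfolding mat_inv_def
proof (rule the_equality)
  show "P \<in> Mat X \<and> mat_mult X M P = mat_one X \<and> mat_mult X P M = mat_one X"
    using assms by blast
next
  fix Q assume Q: "Q \<in> Mat X \<and> mat_mult X M Q = mat_one X \<and> mat_mult X Q M = mat_one X"
  show "Q = P"
  proof (intro ext)
    fix y z
    show "Q y z = P y z"
    proof (cases "y \<in> X \<and> z \<in> X")
      case True
      have MP': "(\<Sum>v\<in>X. M w v * P v z) = (if w = z then 1 else 0)" if "w \<in> X" for w
        using fun_cong[OF fun_cong[OF MP, of w], of z] that True
        by (simp add: mat_mult_def mat_one_def)
      have QM': "(\<Sum>w\<in>X. Q y w * M w v) = (if y = v then 1 else 0)" if "v \<in> X" for v
        using fun_cong[OF fun_cong[OF conjunct2[OF conjunct2[OF Q]], of y], of v] that True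
        by (simp add: mat_mult_def mat_one_def)
      \<comment> \<open>Associativity written out in entries:
        \<open>Q = Q(MP) = (QM)P = P\<close>.\<close>
      have "Q y z = (\<Sum>w\<in>X. Q y w * (\<Sum>v\<in>X. M w v * P v z))"
        using True fin by (simp add: MP' if_distrib sum.delta cong: if_cong)
      also have "\<dots> = (\<Sum>v\<in>X. (\<Sum>w\<in>X. Q y w * M w v) * P v z)"
        unfolding sum_distrib_left sum_distrib_right mult.assoc by (rule sum.swap)
      also have "\<dots> = P y z"
        using True fin by (simp add: QM' if_distrib[of "\<lambda>x. x * _"] sum.delta cong: if_cong)
      finally show ?thesis .
    next
      \<comment> \<open>Membership in \<open>Mat X\<close> fixes both entries as 0 here, so the
        inverse is unique as a function and \<open>THE\<close> is well defined.\<close>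
      case False
      then show ?thesis using Q P unfolding Mat_def by auto
    qed
  qed
qed

lemma mat_inv_diagonal:
  assumes fin: "finite X" and d: "\<And>y. y \<in> X \<Longrightarrow> d y \<noteq> 0"
  shows "mat_inv X (\<lambda>y z. if y \<in> X \<and> y = z then d y else 0)
    = (\<lambda>y z. if y \<in> X \<and> y = z then inverse (d y) else 0)"
proof (rule mat_inv_eqI[OF fin])
  have "mat_mult X (\<lambda>y z. if y \<in> X \<and> y = z then f y else 0)
      (\<lambda>y z. if y \<in> X \<and> y = z then g y else 0) = mat_one X"
    if "\<And>y. y \<in> X \<Longrightarrow> f y * g y = 1" for f g :: "'a \<Rightarrow> complex"
  proof (intro ext)
    fix y z
    have "(\<Sum>w\<in>X. (if y \<in> X \<and> y = w then f y else 0) * (if w \<in> X \<and> w = z then g w else 0))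
      = (\<Sum>w\<in>X. if y = w then (if y = z then 1 else 0) else 0)"
      by (rule sum.cong) (auto simp: that)
    then show "mat_mult X (\<lambda>y z. if y \<in> X \<and> y = z then f y else 0)
      (\<lambda>y z. if y \<in> X \<and> y = z then g y else 0) y z = mat_one X y z"
      using fin by (auto simp: mat_mult_def mat_one_def)
  qed
  then show "mat_mult X (\<lambda>y z. if y \<in> X \<and> y = z then d y else 0)
      (\<lambda>y z. if y \<in> X \<and> y = z then inverse (d y) else 0) = mat_one X"
    "mat_mult X (\<lambda>y z. if y \<in> X \<and> y = z then inverse (d y) else 0)
      (\<lambda>y z. if y \<in> X \<and> y = z then d y else 0) = mat_one X"
    by (simp_all add: d)
qed (auto simp: Mat_def)

section \<open>Sizes of subspaces over a finite field\<close>

locale finite_geometry = finite_dimensional_vector_space scale Basis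
  for scale :: "'a::{field,finite} \<Rightarrow> 'v::ab_group_add \<Rightarrow> 'v" and Basis
begin

text \<open>Each new basis vector \<open>b\<close> multiplies the size by \<open>CARD('a)\<close>,
  since \<open>(c, v) \<mapsto> c b + v\<close> is a bijection from pairs of a scalar and an old
  vector onto the new span.\<close>

lemma card_span_independent:
  assumes "finite B" "independent B"
  shows "finite (span B) \<and> card (span B) = CARD('a) ^ card B"
  using assms
proof (induction B rule: finite_induct)
  case empty
  then show ?case by simp
next
  case (insert b B)
  have b: "b \<notin> span B" and B: "independent B"
    using insert.prems insert.hyps by (auto simp: independent_insert)
  let ?f = "\<lambda>(c, v). scale c b + v"
  have img: "?f ` (UNIV \<times> span B) = span (insert b B)"
  proof (intro set_eqI iffI)
    fix x assume "x \<in> ?f ` (UNIV \<times> span B)"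
    then obtain c v where "x = scale c b + v" "v \<in> span B" by auto
    then have "x - scale c b \<in> span B" by simp
    then show "x \<in> span (insert b B)" by (auto simp: span_breakdown_eq)
  next
    fix x assume "x \<in> span (insert b B)"
    then obtain c where "x - scale c b \<in> span B" by (auto simp: span_breakdown_eq)
    then have "x = ?f (c, x - scale c b)" "(c, x - scale c b) \<in> UNIV \<times> span B" by auto
    then show "x \<in> ?f ` (UNIV \<times> span B)" by (rule image_eqI)
  qed
  have inj: "inj_on ?f (UNIV \<times> span B)"
  proof (rule inj_onI, clarify)
    fix c c' v v'
    assume v: "v \<in> span B" "v' \<in> span B" and eq: "scale c b + v = scale c' b + v'"
    have "scale (c - c') b = v' - v"
      using eq by (simp add: scale_left_diff_distrib algebra_simps)
    then have "scale (c - c') b \<in> span B" using v by (simp add: span_diff)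
    \<comment> \<open>If \<open>c\<close> and \<open>c'\<close> differed, dividing by
      \<open>c - c'\<close> would put \<open>b\<close> into \<open>span B\<close>.\<close>
    then have "scale (inverse (c - c')) (scale (c - c') b) \<in> span B" by (rule span_scale)
    then have "c = c'" using b by (cases "c = c'") auto
    then show "c = c' \<and> v = v'" using eq by simp
  qed
  have IH: "finite (span B)" "card (span B) = CARD('a) ^ card B"
    using insert.IH[OF B] by auto
  have "finite (span (insert b B))" using IH(1) by (subst img[symmetric]) simp
  moreover have "card (span (insert b B)) = card ((UNIV :: 'a set) \<times> span B)"
    by (subst img[symmetric]) (rule card_image[OF inj])
  ultimately show ?case using insert.hyps IH by (simp add: card_cartesian_product)
qed

lemma card_subspace:
  assumes "subspace W"
  shows "finite W" "card W = CARD('a) ^ dim W"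
proof -
  obtain B where B: "B \<subseteq> W" "independent B" "W \<subseteq> span B" "card B = dim W"
    using basis_exists by blast
  have "span B = W" using B(1,3) assms by (simp add: span_minimal subset_antisym)
  then show "finite W" "card W = CARD('a) ^ dim W"
    using card_span_independent[OF finiteI_independent[OF B(2)] B(2)] B(4) by auto
qed

lemma finite_subspaces: "finite (subspaces scale)"
proof -
  have "finite (UNIV :: 'v set)" by (rule card_subspace) (rule subspace_UNIV)
  then have "finite (UNIV :: 'v set set)" by (simp only: finite_Pow_iff flip: Pow_UNIV)
  then show ?thesis by (rule finite_subset[rotated]) simp
qed

section \<open>Covers inside an interval of the subspace lattice\<close>

lemma covers_iff: "covers scale z w \<longleftrightarrow> w \<subseteq> z \<and> dim z = Suc (dim w)"
  unfolding covers_def by auto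

text \<open>For \<open>w \<subseteq> y\<close> these are the atoms of the interval from
  \<open>w\<close> to \<open>y\<close>, and \<open>covers_below\<close> gives its coatoms. Both sets
  are empty when \<open>w\<close> is not contained in \<open>y\<close>.\<close>

definition covers_above :: "'v set \<Rightarrow> 'v set \<Rightarrow> 'v set set" where
  "covers_above w y = {z \<in> subspaces scale. covers scale z w \<and> z \<subseteq> y}"

definition covers_below :: "'v set \<Rightarrow> 'v set \<Rightarrow> 'v set set" where
  "covers_below w y = {z \<in> subspaces scale. covers scale y z \<and> w \<subseteq> z}"

lemma finite_covers: "finite (covers_above w y)" "finite (covers_below w y)"
  unfolding covers_above_def covers_below_def using finite_subspaces by auto

text \<open>Every vector of \<^term>\<open>y - w\<close> spans, together with \<^term>\<open>w\<close>, exactly one cover of \<^term>\<open>w\<close>.\<close>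

lemma card_covers_above:
  assumes w: "subspace w" and y: "subspace y" and wy: "w \<subseteq> y"
  shows "card (covers_above w y) = (\<Sum>i<dim y - dim w. CARD('a) ^ i)"
proof -
  let ?q = "CARD('a)" and ?U = "covers_above w y"
  have cover_eq: "z = span (insert x w)" if "z \<in> ?U" "x \<in> z" "x \<notin> w" for x z
  proof -
    have z: "subspace z" "w \<subseteq> z" "dim z = Suc (dim w)"
      using that(1) by (auto simp: covers_above_def subspaces_def covers_iff)
    have "span (insert x w) \<subseteq> z" using z that by (intro span_minimal) auto
    moreover have "dim (span (insert x w)) = Suc (dim w)"
      using that(3) w by (simp add: dim_insert span_eq_iff[THEN iffD2])
    ultimately show ?thesis
      using subspace_dim_equal[of "span (insert x w)" z] z by simp
  qed
  have part: "y - w = (\<Union>z\<in>?U. z - w)"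
  proof (intro set_eqI iffI)
    fix x assume x: "x \<in> y - w"
    have "span (insert x w) \<subseteq> y" using x y wy by (intro span_minimal) auto
    moreover have "dim (span (insert x w)) = Suc (dim w)"
      using x w by (simp add: dim_insert span_eq_iff[THEN iffD2])
    moreover have "w \<subseteq> span (insert x w)" by (meson span_superset subset_insertI subset_trans)
    ultimately have "span (insert x w) \<in> ?U"
      by (simp add: covers_above_def subspaces_def covers_iff)
    moreover have "x \<in> span (insert x w)" by (simp add: span_base)
    ultimately show "x \<in> (\<Union>z\<in>?U. z - w)" using x by blast
  qed (auto simp: covers_above_def)
  have "card (\<Union>z\<in>?U. z - w) = (\<Sum>z\<in>?U. card (z - w))"
  proof (rule card_UN_disjoint)
    show "\<forall>z\<in>?U. finite (z - w)"
      using card_subspace(1) by (auto simp: covers_above_def subspaces_def)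
    show "\<forall>z\<in>?U. \<forall>z'\<in>?U. z \<noteq> z' \<longrightarrow> (z - w) \<inter> (z' - w) = {}"
      using cover_eq by (metis DiffD1 DiffD2 disjoint_iff)
  qed (rule finite_covers)
  also have "\<dots> = (\<Sum>z\<in>?U. ?q ^ Suc (dim w) - ?q ^ dim w)"
  proof (rule sum.cong)
    fix z assume "z \<in> ?U"
    then have "subspace z" "w \<subseteq> z" "dim z = Suc (dim w)"
      by (auto simp: covers_above_def subspaces_def covers_iff)
    then show "card (z - w) = ?q ^ Suc (dim w) - ?q ^ dim w"
      using card_subspace[of z] card_subspace[OF w] by (simp add: card_Diff_subset)
  qed simp
  finally have "card ?U * (?q ^ Suc (dim w) - ?q ^ dim w) = card (y - w)"
    using part by simp
  also have "\<dots> = ?q ^ dim y - ?q ^ dim w"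
    using card_subspace[OF y] card_subspace[OF w] wy by (simp add: card_Diff_subset)
  also have "?q ^ dim y = ?q ^ dim w * ?q ^ (dim y - dim w)"
    using dim_subset[OF wy] by (simp flip: power_add)
  \<comment> \<open>Counting \<open>y - w\<close> piece by piece gives this equation; a factor
    \<open>?q ^ dim w\<close> splits off both sides and cancels.\<close>
  finally have "?q ^ dim w * (card ?U * (?q - 1)) = ?q ^ dim w * (?q ^ (dim y - dim w) - 1)"
    by (simp add: algebra_simps)
  then have "card ?U * (?q - 1) = ?q ^ (dim y - dim w) - 1" by simp
  \<comment> \<open>Subtraction on naturals truncates; the bounds
    \<open>1 \<le> ?q ^ k \<le> ?q ^ Suc k\<close> keep every difference in the induction
    exact.\<close>
  moreover have "?q ^ k - 1 = (\<Sum>i<k. ?q ^ i) * (?q - 1)" for k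
  proof (induction k)
    case (Suc k)
    have "?q ^ k * (?q - 1) = ?q ^ Suc k - ?q ^ k" by (simp add: algebra_simps)
    moreover have "1 \<le> ?q ^ k" "?q ^ k \<le> ?q ^ Suc k" by simp_all
    ultimately show ?case
      using Suc.IH unfolding sum.lessThan_Suc add_mult_distrib by linarith
  qed simp
  ultimately show ?thesis using card_finite_field_ge2[where 'a='a] by simp
qed

text \<open>Double counting of the pairs \<open>w' \<subseteq> z\<close> with \<open>w'\<close> a cover of \<^term>\<open>w\<close> and \<open>z\<close> covered by \<^term>\<open>y\<close>
  avoids any appeal to the dual space.\<close>

lemma card_covers_below:
  assumes "subspace w" "subspace y" "w \<subseteq> y"
  shows "card (covers_below w y) = (\<Sum>i<dim y - dim w. CARD('a) ^ i)"
  using assms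
proof (induction "dim y - dim w" arbitrary: w)
  case 0
  have "\<not> (covers scale y z \<and> w \<subseteq> z)" for z
    using 0 dim_subset[of w z] by (auto simp: covers_iff)
  then have "covers_below w y = {}" by (auto simp: covers_below_def)
  then show ?case using 0 by simp
next
  case (Suc k)
  let ?q = "CARD('a)"
  show ?case
  proof (cases k)
    \<comment> \<open>Here the double count would only say 0 = 0, its common factor being an empty
      sum, so the single coatom \<open>w\<close> is exhibited directly.\<close>
    case 0
    then have dy: "dim y = Suc (dim w)" using Suc.hyps(2) by simp
    have "covers_below w y = {w}"
    proof (intro set_eqI iffI)
      fix z assume "z \<in> covers_below w y"
      then have "subspace z" "w \<subseteq> z" "dim z = dim w"
        using dy by (auto simp: covers_below_def subspaces_def covers_iff)
      then show "z \<in> {w}" using subspace_dim_equal[of w z] Suc.prems by simp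
    qed (use Suc.prems dy in \<open>auto simp: covers_below_def subspaces_def covers_iff\<close>)
    then show ?thesis using dy by simp
  next
    case k: (Suc j)
    let ?c = "\<Sum>i<k. ?q ^ i"
    let ?U = "covers_above w y" and ?D = "covers_below w y"
    have "card ?U * ?c = (\<Sum>w'\<in>?U. card (covers_below w' y))"
    proof -
      \<comment> \<open>The interval from \<open>w'\<close> to \<open>y\<close> is one step shorter,
        so the induction hypothesis applies.\<close>
      have "card (covers_below w' y) = ?c" if "w' \<in> ?U" for w'
      proof -
        have w': "subspace w'" "w' \<subseteq> y" "dim w' = Suc (dim w)"
          using that by (auto simp: covers_above_def subspaces_def covers_iff)
        then have "k = dim y - dim w'" using Suc.hyps(2) by simp
        then show ?thesis using Suc.hyps(1)[of w'] w' Suc.prems by simp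
      qed
      then show ?thesis by simp
    qed
    also have "\<dots> = (\<Sum>w'\<in>?U. card {z \<in> ?D. w' \<subseteq> z})"
      by (intro sum.cong arg_cong[of _ _ card])
        (auto simp: covers_below_def covers_above_def covers_iff)
    also have "\<dots> = (\<Sum>z\<in>?D. card {w' \<in> ?U. w' \<subseteq> z})"
      using sum.swap_restrict[where A="?U" and B="?D" and g="\<lambda>_ _. 1::nat" and R="(\<subseteq>)"]
        finite_covers by simp
    also have "\<dots> = (\<Sum>z\<in>?D. card (covers_above w z))"
      by (intro sum.cong arg_cong[of _ _ card])
        (auto simp: covers_below_def covers_above_def covers_iff)
    also have "\<dots> = card ?D * ?c"
    proof -
      \<comment> \<open>The other side of the double count needs only atoms, whose number is already
        known.\<close>
      have "card (covers_above w z) = ?c" if "z \<in> ?D" for z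
      proof -
        have z: "subspace z" "w \<subseteq> z" "dim y = Suc (dim z)"
          using that by (auto simp: covers_below_def subspaces_def covers_iff)
        then have "k = dim z - dim w" using Suc.hyps(2) by simp
        then show ?thesis using card_covers_above[of w z] z Suc.prems by simp
      qed
      then show ?thesis by simp
    qed
    finally have "card ?U * ?c = card ?D * ?c" .
    moreover have "?c > 0" using k by (intro sum_pos) (auto simp: zero_less_power)
    ultimately have "card ?D = card ?U" by (metis less_irrefl mult_cancel2)
    then show ?thesis using card_covers_above[OF Suc.prems] by simp
  qed
qed

section \<open>Powers of L and the vectors \<open>ddown\<close>\<close>

lemma mat_pow_L:
  assumes "w \<in> subspaces scale" "y \<in> subspaces scale"
  shows "mat_pow (subspaces scale) (L_mat scale) i w y =
    (if w \<subseteq> y \<and> dim y = dim w + i then q_fact CARD('a) i else 0)"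
  using assms
proof (induction i arbitrary: w)
  case 0
  have "w = y" if "w \<subseteq> y" "dim y = dim w"
    using that 0 subspace_dim_equal[of w y] by (simp add: subspaces_def)
  then show ?case using 0 by (auto simp: mat_one_def q_fact_def)
next
  case (Suc i)
  let ?X = "subspaces scale" and ?q = "CARD('a)"
  \<comment> \<open>A chain is split at the cover \<open>z\<close> of \<open>w\<close> with which it
    starts. The rest runs from \<open>z\<close> to \<open>y\<close> in \<open>i\<close> steps, and
    its count does not depend on \<open>z\<close>; the number of choices of \<open>z\<close>
    supplies the factor \<open>[i + 1]\<close>.\<close>
  have "mat_pow ?X (L_mat scale) (Suc i) w y =
      (\<Sum>z\<in>?X. if z \<in> covers_above w y \<and> dim y = dim w + Suc i then q_fact ?q i else 0)"
    using Suc by (auto simp: mat_mult_def L_mat_def covers_above_def covers_iff intro!: sum.cong)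
  also have "\<dots> = (\<Sum>z\<in>covers_above w y. if dim y = dim w + Suc i then q_fact ?q i else 0)"
    by (rule sum.mono_neutral_cong_right[OF finite_subspaces]) (auto simp: covers_above_def)
  also have "\<dots> = (if dim y = dim w + Suc i then of_nat (card (covers_above w y)) * q_fact ?q i else 0)"
    by simp
  also have "\<dots> = (if w \<subseteq> y \<and> dim y = dim w + Suc i then q_fact ?q (Suc i) else 0)"
  proof (cases "w \<subseteq> y")
    case True
    then have "of_nat (card (covers_above w y)) = q_int ?q (dim y - dim w)"
      using card_covers_above[of w y] Suc.prems
      by (simp add: subspaces_def q_int_eq_sum[OF card_finite_field_ge2])
    then show ?thesis using True by (simp add: q_fact_Suc)
  next
    case False
    then have "covers_above w y = {}" by (auto simp: covers_above_def covers_iff)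
    then show ?thesis using False by simp
  qed
  finally show ?case .
qed

lemma ddown_eq:
  assumes y: "y \<in> subspaces scale"
  shows "ddown scale y = (\<lambda>w. if w \<in> subspaces scale \<and> w \<subseteq> y then 1 else 0)"
proof
  fix w
  let ?X = "subspaces scale" and ?q = "CARD('a)"
  have "q_exp ?X ?q (L_mat scale) w y = (if w \<subseteq> y then 1 else 0)" if w: "w \<in> ?X"
  proof -
    \<comment> \<open>For \<open>w \<subseteq> y\<close> only the exponent
      \<open>dim y - dim w\<close> contributes, and its chain count cancels the q-factorial.
      Otherwise every term is 0, so the same one-element range serves.\<close>
    have "q_exp ?X ?q (L_mat scale) w y =
      (\<Sum>i\<in>{dim y - dim w}. 1 / q_fact ?q i * mat_pow ?X (L_mat scale) i w y)"
      unfolding q_exp_def by (rule suminf_finite) (auto simp: mat_pow_L[OF w y])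
    then show ?thesis
      using q_fact_nonzero[OF card_finite_field_ge2[where 'a='a]] dim_subset[of w y]
      by (auto simp: mat_pow_L[OF w y])
  qed
  then show "ddown scale y w = (if w \<in> ?X \<and> w \<subseteq> y then 1 else 0)"
    using y finite_subspaces
    by (auto simp: ddown_def mat_vec_def unit_vec_def if_distrib sum.delta' cong: if_cong)
qed

section \<open>Action of the matrices on an arbitrary vector\<close>

lemma A_star_inv_eq:
  "A_star_inv scale = (\<lambda>y z. if y \<in> subspaces scale \<and> y = z then of_nat CARD('a) ^ dim y else 0)"
  unfolding A_star_inv_def A_star_def
  by (subst mat_inv_diagonal[OF finite_subspaces]) (auto simp: power_int_minus fun_eq_iff)

lemma mat_vec_A_star_inv:
  assumes "w \<in> subspaces scale"
  shows "mat_vec (subspaces scale) (A_star_inv scale) v w = of_nat CARD('a) ^ dim w * v w"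
proof -
  have "mat_vec (subspaces scale) (A_star_inv scale) v w =
      (\<Sum>z\<in>subspaces scale. if w = z then of_nat CARD('a) ^ dim w * v w else 0)"
    using assms by (auto simp: mat_vec_def A_star_inv_eq intro!: sum.cong)
  then show ?thesis using assms finite_subspaces by simp
qed

text \<open>Each column of the product is \<open>A_star_inv\<close> applied to a column of
  \<open>L_mat\<close>, so row \<open>w\<close> is merely rescaled.\<close>

lemma A_star_inv_mult_L:
  "mat_mult (subspaces scale) (A_star_inv scale) (L_mat scale)
    = (\<lambda>w z. of_nat CARD('a) ^ dim w * L_mat scale w z)"
proof (intro ext)
  fix w z
  let ?X = "subspaces scale"
  show "mat_mult ?X (A_star_inv scale) (L_mat scale) w z = of_nat CARD('a) ^ dim w * L_mat scale w z"
  proof (cases "w \<in> ?X \<and> z \<in> ?X")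
    case True
    then show ?thesis
      using mat_vec_A_star_inv[of w "\<lambda>u. L_mat scale u z"] by (simp add: mat_mult_def mat_vec_def)
  qed (auto simp: mat_mult_def L_mat_def)
qed

lemma mat_vec_A_star:
  assumes "w \<in> subspaces scale"
  shows "mat_vec (subspaces scale) (A_star scale) v w = of_nat CARD('a) powi (- int (dim w)) * v w"
proof -
  have "mat_vec (subspaces scale) (A_star scale) v w =
      (\<Sum>z\<in>subspaces scale. if w = z then of_nat CARD('a) powi (- int (dim w)) * v w else 0)"
    using assms by (auto simp: mat_vec_def A_star_def intro!: sum.cong)
  then show ?thesis using assms finite_subspaces by simp
qed

lemma mat_vec_A_plus:
  assumes "w \<in> subspaces scale"
  shows "mat_vec (subspaces scale) (A_plus scale) v w =
    of_nat CARD('a) ^ dim w / (of_nat CARD('a) - 1) * v w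
      - mat_vec (subspaces scale) (R_mat scale) v w"
proof -
  have "mat_vec (subspaces scale) (A_plus scale) v w =
      mat_vec (subspaces scale) (A_star_inv scale) v w / (of_nat CARD('a) - 1)
      - mat_vec (subspaces scale) (R_mat scale) v w"
    by (simp add: mat_vec_def A_plus_def left_diff_distrib sum_subtractf sum_divide_distrib)
  then show ?thesis using mat_vec_A_star_inv[OF assms] by simp
qed

lemma mat_vec_A_minus:
  assumes "w \<in> subspaces scale"
  shows "mat_vec (subspaces scale) (A_minus scale) v w =
    of_nat CARD('a) ^ dim w / (of_nat CARD('a) - 1) * v w
      + of_nat CARD('a) ^ dim w * mat_vec (subspaces scale) (L_mat scale) v w"
proof -
  have "mat_vec (subspaces scale) (A_minus scale) v w =
      mat_vec (subspaces scale) (A_star_inv scale) v w / (of_nat CARD('a) - 1)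
      + of_nat CARD('a) ^ dim w * mat_vec (subspaces scale) (L_mat scale) v w"
    by (simp add: mat_vec_def A_minus_def A_star_inv_mult_L distrib_right sum.distrib
        sum_divide_distrib sum_distrib_left mult.assoc)
  then show ?thesis using mat_vec_A_star_inv[OF assms] by simp
qed

text \<open>The matrix identity holds entrywise: R and L match at once, and the coefficient
  \<open>(\<phi> - 1)/(q - 1)\<close> is \<open>\<phi>/(q - 1)\<close> minus
  \<open>1/(q - 1)\<close>.\<close>

lemma mat_vec_A_mat:
  "mat_vec (subspaces scale) (A_mat scale \<phi>) v w =
    of_real \<phi> * mat_vec (subspaces scale) (A_minus scale) v w
      - mat_vec (subspaces scale) (A_plus scale) v w"
proof -
  have "A_mat scale \<phi> w z = of_real \<phi> * A_minus scale w z - A_plus scale w z" for z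
    by (simp add: A_mat_def A_minus_def A_plus_def algebra_simps diff_divide_distrib)
  then show ?thesis
    by (simp add: mat_vec_def left_diff_distrib sum_subtractf sum_distrib_left mult.assoc)
qed

section \<open>Action on \<open>ddown\<close> as a count of covers\<close>

lemma mat_vec_L_ddown:
  assumes "w \<in> subspaces scale" "y \<in> subspaces scale"
  shows "mat_vec (subspaces scale) (L_mat scale) (ddown scale y) w = of_nat (card (covers_above w y))"
proof -
  have "mat_vec (subspaces scale) (L_mat scale) (ddown scale y) w =
      (\<Sum>z\<in>subspaces scale. if z \<in> covers_above w y then 1 else 0)"
    using assms by (auto simp: mat_vec_def L_mat_def ddown_eq covers_above_def intro!: sum.cong)
  also have "\<dots> = (\<Sum>z\<in>covers_above w y. 1)"
    by (rule sum.mono_neutral_cong_right[OF finite_subspaces]) (auto simp: covers_above_def)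
  finally show ?thesis by simp
qed

lemma mat_vec_R_ddown:
  assumes "w \<in> subspaces scale" "y \<in> subspaces scale"
  shows "mat_vec (subspaces scale) (R_mat scale) (ddown scale y) w
    = of_nat (card {z \<in> subspaces scale. covers scale w z \<and> z \<subseteq> y})"
    (is "_ = of_nat (card ?Z)")
proof -
  have "mat_vec (subspaces scale) (R_mat scale) (ddown scale y) w =
      (\<Sum>z\<in>subspaces scale. if z \<in> ?Z then 1 else 0)"
    using assms by (auto simp: mat_vec_def R_mat_def ddown_eq intro!: sum.cong)
  also have "\<dots> = (\<Sum>z\<in>?Z. 1)"
    by (rule sum.mono_neutral_cong_right[OF finite_subspaces]) auto
  finally show ?thesis by simp
qed

text \<open>A sum of indicators is a count. With \<open>P\<close> a covering condition this turns
  the sums on the right-hand sides of the identities into numbers of covers.\<close>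

lemma sum_ddown:
  assumes "w \<in> subspaces scale"
  shows "(\<Sum>z\<in>{z \<in> subspaces scale. P z}. ddown scale z w)
    = of_nat (card {z \<in> subspaces scale. P z \<and> w \<subseteq> z})"
proof -
  have "(\<Sum>z\<in>{z \<in> subspaces scale. P z}. ddown scale z w)
      = (\<Sum>z\<in>{z \<in> subspaces scale. P z \<and> w \<subseteq> z}. 1)"
    using assms finite_subspaces by (intro sum.mono_neutral_cong_right) (auto simp: ddown_eq)
  then show ?thesis by simp
qed

section \<open>Sums of subspaces and the modular law\<close>

lemma subset_subspace_sums:
  assumes "subspace w" "subspace y"
  shows "w \<subseteq> {a + b |a b. a \<in> w \<and> b \<in> y}"
    "y \<subseteq> {a + b |a b. a \<in> w \<and> b \<in> y}"
proof -
  show "w \<subseteq> {a + b |a b. a \<in> w \<and> b \<in> y}"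
  proof
    fix x assume "x \<in> w"
    then have "x = x + 0 \<and> x \<in> w \<and> 0 \<in> y" using subspace_0[OF assms(2)] by simp
    then show "x \<in> {a + b |a b. a \<in> w \<and> b \<in> y}" by blast
  qed
  show "y \<subseteq> {a + b |a b. a \<in> w \<and> b \<in> y}"
  proof
    fix x assume "x \<in> y"
    then have "x = 0 + x \<and> 0 \<in> w \<and> x \<in> y" using subspace_0[OF assms(1)] by simp
    then show "x \<in> {a + b |a b. a \<in> w \<and> b \<in> y}" by blast
  qed
qed

text \<open>The only candidates are \<^term>\<open>w \<inter> y\<close> on the left and the sum of \<^term>\<open>w\<close> and \<^term>\<open>y\<close> on the
  right, and the modular law says that both qualify or neither does.\<close>

lemma card_covers_not_subset:
  assumes w: "subspace w" and y: "subspace y" and "\<not> w \<subseteq> y"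
  shows "card {z \<in> subspaces scale. covers scale w z \<and> z \<subseteq> y}
    = card {z \<in> subspaces scale. covers scale z y \<and> w \<subseteq> z}"
proof -
  let ?i = "w \<inter> y"
  define t where "t = {a + b |a b. a \<in> w \<and> b \<in> y}"
  have i: "subspace ?i" using w y by (rule subspace_inter)
  note t = subspace_sums[OF w y, folded t_def] subset_subspace_sums[OF w y, folded t_def]
  have dims: "dim t + dim ?i = dim w + dim y" unfolding t_def by (rule dim_sums_Int[OF w y])
  have lti: "dim ?i < dim w"
    using subspace_dim_equal[OF i w] dim_subset[of ?i w] assms(3) by fastforce
  have ltt: "dim y < dim t" using lti dims by linarith
  have "{z \<in> subspaces scale. covers scale w z \<and> z \<subseteq> y} = (if dim w = Suc (dim ?i) then {?i} else {})"
  proof -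
    \<comment> \<open>Such a \<open>z\<close> lies in \<open>w \<inter> y\<close> and has dimension
      \<open>dim w - 1\<close>, which is at least \<open>dim (w \<inter> y)\<close> because the
      intersection is proper in \<open>w\<close>.\<close>
    have "z = ?i" if "subspace z" "covers scale w z" "z \<subseteq> y" for z
    proof (rule subspace_dim_equal[OF that(1) i])
      show "z \<subseteq> ?i" "dim ?i \<le> dim z" using that lti by (auto simp: covers_iff)
    qed
    moreover have "?i \<in> subspaces scale" using i by (simp add: subspaces_def)
    moreover have "covers scale w ?i \<longleftrightarrow> dim w = Suc (dim ?i)" by (simp add: covers_iff)
    ultimately have "z \<in> subspaces scale \<and> covers scale w z \<and> z \<subseteq> y
        \<longleftrightarrow> dim w = Suc (dim ?i) \<and> z = ?i" for z
      unfolding subspaces_def mem_Collect_eq by (metis inf_le2)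
    then show ?thesis by simp
  qed
  moreover have "{z \<in> subspaces scale. covers scale z y \<and> w \<subseteq> z}
      = (if dim t = Suc (dim y) then {t} else {})"
  proof -
    \<comment> \<open>Dually, \<open>z\<close> contains the sum \<open>t\<close>, while
      \<open>dim z = dim y + 1\<close> is at most \<open>dim t\<close>.\<close>
    have "z = t" if "subspace z" "covers scale z y" "w \<subseteq> z" for z
    proof (rule subspace_dim_equal[OF t(1) that(1), symmetric])
      have "y \<subseteq> z" using that by (simp add: covers_iff)
      then show "t \<subseteq> z" using that(1,3) subspace_add unfolding t_def by blast
      show "dim z \<le> dim t" using that ltt by (simp add: covers_iff)
    qed
    moreover have "t \<in> subspaces scale" using t(1) by (simp add: subspaces_def)
    moreover have "covers scale t y \<longleftrightarrow> dim t = Suc (dim y)" using t(3) by (simp add: covers_iff)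
    ultimately have "z \<in> subspaces scale \<and> covers scale z y \<and> w \<subseteq> z
        \<longleftrightarrow> dim t = Suc (dim y) \<and> z = t" for z
      using t(2) unfolding subspaces_def mem_Collect_eq by metis
    then show ?thesis by simp
  qed
  moreover have "dim w = Suc (dim ?i) \<longleftrightarrow> dim t = Suc (dim y)" using dims by linarith
  ultimately show ?thesis by simp
qed

section \<open>Counts as q-integers, and the identities entry by entry\<close>

lemma card_covers_above_q_int:
  assumes "w \<in> subspaces scale" "y \<in> subspaces scale"
  shows "of_nat (card (covers_above w y)) = (if w \<subseteq> y then q_int CARD('a) (dim y - dim w) else 0)"
proof (cases "w \<subseteq> y")
  case True
  then show ?thesis
    using assms by (simp add: card_covers_above subspaces_def q_int_eq_sum[OF card_finite_field_ge2])
next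
  case False
  then have "covers_above w y = {}" by (auto simp: covers_above_def covers_iff)
  then show ?thesis using False by simp
qed

lemma card_covers_below_q_int:
  assumes "w \<in> subspaces scale" "y \<in> subspaces scale"
  shows "of_nat (card (covers_below w y)) = (if w \<subseteq> y then q_int CARD('a) (dim y - dim w) else 0)"
proof (cases "w \<subseteq> y")
  case True
  then show ?thesis
    using assms by (simp add: card_covers_below subspaces_def q_int_eq_sum[OF card_finite_field_ge2])
next
  case False
  then have "covers_below w y = {}" by (auto simp: covers_below_def covers_iff)
  then show ?thesis using False by simp
qed

lemma q_minus_1_nonzero: "(of_nat CARD('a) :: complex) - 1 \<noteq> 0"
  using card_finite_field_ge2[where 'a='a] by simp

text \<open>For \<open>w \<subseteq> y\<close> and \<open>k = dim y - dim w\<close>, the entry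
  \<open>q^(-dim w)\<close> equals \<open>q^(-dim y) * q^k\<close>, and
  \<open>q^k = 1 + (q - 1)[k]\<close>, where \<open>[k]\<close> counts the coatoms above
  \<open>w\<close>.\<close>

lemma A_star_ddown:
  assumes y: "y \<in> subspaces scale" and w: "w \<in> subspaces scale"
  shows "mat_vec (subspaces scale) (A_star scale) (ddown scale y) w =
    of_nat CARD('a) powi (- int (dim y)) * ddown scale y w
      + (of_nat CARD('a) - 1) * of_nat CARD('a) powi (- int (dim y))
        * (\<Sum>z\<in>{z \<in> subspaces scale. covers scale y z}. ddown scale z w)"
proof -
  let ?q = "of_nat CARD('a) :: complex"
  have "?q powi (- int (dim w)) = ?q powi (- int (dim y)) * ?q ^ (dim y - dim w)" if "w \<subseteq> y"
    using dim_subset[OF that] by (simp add: power_int_minus field_simps flip: power_add)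
  moreover have "?q ^ k = 1 + (?q - 1) * q_int CARD('a) k" for k
    using q_minus_1_nonzero by (simp add: q_int_def)
  moreover have "(\<Sum>z\<in>{z \<in> subspaces scale. covers scale y z}. ddown scale z w) =
      (if w \<subseteq> y then q_int CARD('a) (dim y - dim w) else 0)"
    using sum_ddown[OF w, of "covers scale y"] card_covers_below_q_int[OF w y]
    by (simp add: covers_below_def)
  ultimately show ?thesis
    unfolding mat_vec_A_star[OF w] using w y by (simp add: ddown_eq algebra_simps)
qed

text \<open>For \<open>w \<subseteq> y\<close> both sides equal \<open>1/(q - 1)\<close>, because
  \<open>q^n/(q - 1) - [n] = 1/(q - 1)\<close> for every \<open>n\<close>: the left side has
  \<open>n = dim w\<close>, the right side \<open>n = dim UNIV - dim y\<close>.\<close>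

lemma A_plus_ddown:
  assumes y: "y \<in> subspaces scale" and w: "w \<in> subspaces scale"
  shows "mat_vec (subspaces scale) (A_plus scale) (ddown scale y) w =
    of_nat CARD('a) powi (int (dim UNIV) - int (dim y)) / (of_nat CARD('a) - 1) * ddown scale y w
      - (\<Sum>z\<in>{z \<in> subspaces scale. covers scale z y}. ddown scale z w)"
proof (cases "w \<subseteq> y")
  case True
  let ?q = "of_nat CARD('a) :: complex"
  have X: "{0} \<in> subspaces scale" "UNIV \<in> subspaces scale" by (auto simp: subspaces_def)
  \<comment> \<open>Since \<open>w \<subseteq> y\<close>, the bound by \<open>y\<close> is
    automatic, and every subspace contains \<open>{0}\<close>; so all hyperplanes of
    \<open>w\<close> are counted.\<close>
  have "{z \<in> subspaces scale. covers scale w z \<and> z \<subseteq> y} = covers_below {0} w"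
    using True by (auto simp: covers_below_def covers_iff subspaces_def dest: subspace_0)
  then have 1: "mat_vec (subspaces scale) (R_mat scale) (ddown scale y) w = q_int CARD('a) (dim w)"
    using mat_vec_R_ddown[OF w y] card_covers_below_q_int[OF X(1) w] subspace_0 w
    by (simp add: subspaces_def)
  have "{z \<in> subspaces scale. covers scale z y \<and> w \<subseteq> z} = covers_above y UNIV"
    using True by (auto simp: covers_above_def covers_iff)
  then have 2: "(\<Sum>z\<in>{z \<in> subspaces scale. covers scale z y}. ddown scale z w)
      = q_int CARD('a) (dim UNIV - dim y)"
    using sum_ddown[OF w, of "\<lambda>z. covers scale z y"] card_covers_above_q_int[OF y X(2)] by simp
  have "int (dim UNIV) - int (dim y) = int (dim UNIV - dim y)"
    using dim_subset[OF subset_UNIV, of y] by simp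
  then have 3: "?q powi (int (dim UNIV) - int (dim y)) = ?q ^ (dim UNIV - dim y)"
    by (simp only: power_int_of_nat)
  show ?thesis
    unfolding mat_vec_A_plus[OF w] 1 2 3
    using True w y q_minus_1_nonzero by (simp add: ddown_eq q_int_def flip: diff_divide_distrib)
next
  case False
  then show ?thesis
    unfolding mat_vec_A_plus[OF w] mat_vec_R_ddown[OF w y] sum_ddown[OF w]
    using card_covers_not_subset[of w y] w y by (simp add: ddown_eq subspaces_def)
qed

text \<open>With \<open>k = dim y - dim w\<close>, the entry at \<open>w \<subseteq> y\<close> is
  \<open>q^(dim w) * (1/(q - 1) + [k])\<close>, and the bracket equals
  \<open>q^k/(q - 1)\<close>.\<close>

lemma A_minus_ddown:
  assumes y: "y \<in> subspaces scale" and w: "w \<in> subspaces scale"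
  shows "mat_vec (subspaces scale) (A_minus scale) (ddown scale y) w =
    of_nat CARD('a) ^ dim y / (of_nat CARD('a) - 1) * ddown scale y w"
proof (cases "w \<subseteq> y")
  case True
  let ?q = "of_nat CARD('a) :: complex"
  have "?q ^ dim y = ?q ^ dim w * ?q ^ (dim y - dim w)"
    using dim_subset[OF True] by (simp flip: power_add)
  then show ?thesis
    unfolding mat_vec_A_minus[OF w] mat_vec_L_ddown[OF w y] card_covers_above_q_int[OF w y]
    using True w y q_minus_1_nonzero
    by (simp add: ddown_eq q_int_def right_diff_distrib flip: add_divide_distrib)
next
  case False
  then show ?thesis
    unfolding mat_vec_A_minus[OF w] mat_vec_L_ddown[OF w y] card_covers_above_q_int[OF w y]
    using w y by (simp add: ddown_eq)
qed

end

section \<open>From entries to identities of vectors\<close>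

theorem lemma15p11:
  fixes s :: "'a::{field,finite} \<Rightarrow> 'v::ab_group_add \<Rightarrow> 'v"
    and q N :: nat and \<phi> :: real and y :: "'v set"
  assumes "vector_space s"
    and "q = CARD('a)"
    and "N \<ge> 1" and "vector_space.dim s UNIV = N"
    and "\<phi> > 0"
    and "y \<in> subspaces s"
  shows "(mat_vec (subspaces s) (A_star s) (ddown s y) =
      (\<lambda>w. of_nat q powi (- int (vector_space.dim s y)) * ddown s y w
         + (of_nat q - 1) * of_nat q powi (- int (vector_space.dim s y))
             * (\<Sum>z\<in>{z \<in> subspaces s. covers s y z}. ddown s z w)))
    \<and> (mat_vec (subspaces s) (A_plus s) (ddown s y) =
      (\<lambda>w. of_nat q powi (int N - int (vector_space.dim s y)) / (of_nat q - 1) * ddown s y w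
         - (\<Sum>z\<in>{z \<in> subspaces s. covers s z y}. ddown s z w)))
    \<and> (mat_vec (subspaces s) (A_minus s) (ddown s y) =
      (\<lambda>w. of_nat q ^ vector_space.dim s y / (of_nat q - 1) * ddown s y w))
    \<and> (mat_vec (subspaces s) (A_mat s \<phi>) (ddown s y) =
      (\<lambda>w. (of_real \<phi> * of_nat q ^ vector_space.dim s y
              - of_nat q powi (int N - int (vector_space.dim s y))) / (of_nat q - 1) * ddown s y w
         + (\<Sum>z\<in>{z \<in> subspaces s. covers s z y}. ddown s z w)))"
proof -
  interpret vector_space s by fact
  obtain B where B: "independent B" "UNIV \<subseteq> span B" "card B = N"
    using basis_exists[of UNIV] assms(4) by metis
  \<comment> \<open>\<open>card\<close> is 0 on infinite sets, so \<open>N \<ge> 1\<close> forces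
    the basis to be finite.\<close>
  have "finite B" using B(3) assms(3) by (intro card_ge_0_finite) simp
  then interpret finite_geometry s B
    using B(1,2) by unfold_locales auto
  let ?X = "subspaces s"
  \<comment> \<open>Equality of functions must also be checked at arguments that are not subspaces,
    where both sides vanish.\<close>
  have off: "mat_vec ?X M v w = 0" if "w \<notin> ?X" for M v w
    using that by (simp add: mat_vec_def)
  have off': "ddown s z w = 0" if "w \<notin> ?X" for z w
    using that by (simp add: ddown_def mat_vec_def)
  note y = assms(6)
  show ?thesis
    unfolding assms(2) assms(4)[symmetric]
  proof (intro conjI ext)
    fix w
    show "mat_vec ?X (A_star s) (ddown s y) w =
      of_nat CARD('a) powi (- int (dim y)) * ddown s y w
         + (of_nat CARD('a) - 1) * of_nat CARD('a) powi (- int (dim y))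
             * (\<Sum>z\<in>{z \<in> ?X. covers s y z}. ddown s z w)"
      using A_star_ddown[OF y] by (cases "w \<in> ?X") (simp_all add: off off')
    show plus: "mat_vec ?X (A_plus s) (ddown s y) w =
      of_nat CARD('a) powi (int (dim UNIV) - int (dim y)) / (of_nat CARD('a) - 1) * ddown s y w
         - (\<Sum>z\<in>{z \<in> ?X. covers s z y}. ddown s z w)"
      using A_plus_ddown[OF y] by (cases "w \<in> ?X") (simp_all add: off off')
    show minus: "mat_vec ?X (A_minus s) (ddown s y) w =
      of_nat CARD('a) ^ dim y / (of_nat CARD('a) - 1) * ddown s y w"
      using A_minus_ddown[OF y] by (cases "w \<in> ?X") (simp_all add: off off')
    show "mat_vec ?X (A_mat s \<phi>) (ddown s y) w =
      (of_real \<phi> * of_nat CARD('a) ^ dim y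
          - of_nat CARD('a) powi (int (dim UNIV) - int (dim y))) / (of_nat CARD('a) - 1) * ddown s y w
         + (\<Sum>z\<in>{z \<in> ?X. covers s z y}. ddown s z w)"
      unfolding mat_vec_A_mat plus minus by (simp add: left_diff_distrib diff_divide_distrib)
  qed
qed

end
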